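(* Let $G$ be a graph on $n$ vertices with average degree ${\rm d}$. Then: (i) $\displaystyle \omega(G) \ge \varphi(G) \ge \sum_{v \in V(G)} \frac{1}{n-\deg(v)} \ge \frac{n}{n - {\rm d}}$; (ii) $\displaystyle \alpha(G) \ge \Omega(G) \ge \sum_{v \in V(G)} \frac{1}{\deg(v)+1} \ge \frac{n}{{\rm d} + 1}$.
   Context: Graphs are finite and simple with nonempty vertex set; $n = |V(G)|$ and ${\rm d} = \frac{1}{n}\sum_{v \in V(G)} \deg(v)$. A set $A \subseteq V(G)$ is small if $\deg(v) \le n - |A|$ for every $v \in A$. A set $B \subseteq V(G)$ is large if $\deg(v) \ge |B| - 1$ for every $v \in B$. $\varphi(G)$ (resp. $\Omega(G)$) is the minimum integer $t$ such that $V(G)$ can be partitioned into $t$ small (resp. large) sets. $\alpha(G)$ is the independence number and $\omega(G)$ the clique number of $G$. *)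

theory Defs
  imports Complex_Main "HOL-Library.Ramsey" "HOL-Library.Disjoint_Sets"
begin

text \<open>Edges are the two-element vertex sets, so that \<^const>\<open>clique\<close> and \<^const>\<open>indep\<close>
  from the Ramsey theory apply directly.\<close>

locale simple_graph =
  fixes V :: "'a set" and E :: "'a set set"
  assumes finite_V: "finite V"
    and V_nonempty: "V \<noteq> {}"
    and E_subset: "E \<subseteq> [V]\<^bsup>2\<^esup>"

definition degree :: "'a set \<Rightarrow> 'a set set \<Rightarrow> 'a \<Rightarrow> nat" where
  "degree V E v = card {u \<in> V. {v, u} \<in> E}"

definition avg_degree :: "'a set \<Rightarrow> 'a set set \<Rightarrow> real" where
  "avg_degree V E = 1 / real (card V) * (\<Sum>v\<in>V. real (degree V E v))"

text \<open>The differences below are taken in \<^typ>\<open>int\<close>, since \<^typ>\<open>nat\<close> subtraction truncates.\<close>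

definition small_set :: "'a set \<Rightarrow> 'a set set \<Rightarrow> 'a set \<Rightarrow> bool" where
  "small_set V E A \<longleftrightarrow>
     A \<subseteq> V \<and> (\<forall>v\<in>A. int (degree V E v) \<le> int (card V) - int (card A))"

definition large_set :: "'a set \<Rightarrow> 'a set set \<Rightarrow> 'a set \<Rightarrow> bool" where
  "large_set V E B \<longleftrightarrow>
     B \<subseteq> V \<and> (\<forall>v\<in>B. int (degree V E v) \<ge> int (card B) - 1)"

definition small_partition_number :: "'a set \<Rightarrow> 'a set set \<Rightarrow> nat" (\<open>\<phi>\<close>) where
  "\<phi> V E = (LEAST t. \<exists>P. partition_on V P \<and> card P = t \<and> (\<forall>A\<in>P. small_set V E A))"

definition large_partition_number :: "'a set \<Rightarrow> 'a set set \<Rightarrow> nat" (\<open>\<Omega>\<close>) where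
  "\<Omega> V E = (LEAST t. \<exists>P. partition_on V P \<and> card P = t \<and> (\<forall>B\<in>P. large_set V E B))"

definition clique_number :: "'a set \<Rightarrow> 'a set set \<Rightarrow> nat" (\<open>\<omega>\<close>) where
  "\<omega> V E = Max {card K | K. K \<subseteq> V \<and> clique K E}"

definition independence_number :: "'a set \<Rightarrow> 'a set set \<Rightarrow> nat" (\<open>\<alpha>\<close>) where
  "\<alpha> V E = Max {card I | I. I \<subseteq> V \<and> indep I E}"

context simple_graph
begin

text \<open>The minima and maxima above are attained: the partition into singletons consists of sets
  that are both small and large, and the empty set is both a clique and independent.\<close>

lemma degree_less: "v \<in> V \<Longrightarrow> degree V E v < card V"
proof -
  assume v: "v \<in> V"
  have "{v, v} \<notin> E" using E_subset by (auto simp: nsets_def)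
  then have "{u \<in> V. {v, u} \<in> E} \<subset> V" using v by blast
  then show ?thesis unfolding degree_def using finite_V by (simp add: psubset_card_mono)
qed

lemma partition_on_singletons: "partition_on V ((\<lambda>v. {v}) ` V)"
  by (auto simp: partition_on_def disjoint_def)

lemma small_partition_number_attained:
  "\<exists>P. partition_on V P \<and> card P = \<phi> V E \<and> (\<forall>A\<in>P. small_set V E A)"
proof -
  have "\<forall>A\<in>(\<lambda>v. {v}) ` V. small_set V E A"
    using degree_less by (fastforce simp: small_set_def)
  then have "\<exists>t P. partition_on V P \<and> card P = t \<and> (\<forall>A\<in>P. small_set V E A)"
    using partition_on_singletons by blast
  from LeastI_ex[OF this] show ?thesis
    unfolding small_partition_number_def .
qed

lemma large_partition_number_attained:
  "\<exists>P. partition_on V P \<and> card P = \<Omega> V E \<and> (\<forall>B\<in>P. large_set V E B)"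
proof -
  have "\<forall>B\<in>(\<lambda>v. {v}) ` V. large_set V E B"
    by (auto simp: large_set_def)
  then have "\<exists>t P. partition_on V P \<and> card P = t \<and> (\<forall>B\<in>P. large_set V E B)"
    using partition_on_singletons by blast
  from LeastI_ex[OF this] show ?thesis
    unfolding large_partition_number_def .
qed

lemma clique_number_attained: "\<exists>K\<subseteq>V. clique K E \<and> card K = \<omega> V E"
proof -
  have "\<omega> V E \<in> {card K | K. K \<subseteq> V \<and> clique K E}"
    unfolding clique_number_def
  proof (rule Max_in)
    have "{card K | K. K \<subseteq> V \<and> clique K E} \<subseteq> card ` Pow V" by blast
    then show "finite {card K | K. K \<subseteq> V \<and> clique K E}"
      using finite_V by (meson finite_Pow_iff finite_imageI finite_subset)
    have "{} \<subseteq> V \<and> clique {} E" by simp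
    then show "{card K | K. K \<subseteq> V \<and> clique K E} \<noteq> {}" by blast
  qed
  then show ?thesis by auto
qed

lemma independence_number_attained: "\<exists>I\<subseteq>V. indep I E \<and> card I = \<alpha> V E"
proof -
  have "\<alpha> V E \<in> {card I | I. I \<subseteq> V \<and> indep I E}"
    unfolding independence_number_def
  proof (rule Max_in)
    have "{card I | I. I \<subseteq> V \<and> indep I E} \<subseteq> card ` Pow V" by blast
    then show "finite {card I | I. I \<subseteq> V \<and> indep I E}"
      using finite_V by (meson finite_Pow_iff finite_imageI finite_subset)
    have "{} \<subseteq> V \<and> indep {} E" by simp
    then show "{card I | I. I \<subseteq> V \<and> indep I E} \<noteq> {}" by blast
  qed
  then show ?thesis by auto
qed

end

end

theory Submission
  imports Defs
begin

text \<open>A set is small (large) if its cardinality is at most \<open>n - deg v\<close> (\<open>deg v + 1\<close>) for each of its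
  elements \<open>v\<close>, and these bounds are the numbers of vertices in the closed neighbourhood of \<open>v\<close> in
  the complement of the graph (in the graph itself). Repeatedly picking a remaining vertex \<open>v\<close> whose
  bound is least, and removing the remaining part of its closed neighbourhood as a block, partitions
  the vertices into small (large) sets; the picked vertices form a clique (an independent set), with
  one vertex in each block. In any such partition the reciprocals of the bounds sum to at most
  \<open>1\<close> over each block. The last inequality compares the harmonic and arithmetic means.\<close>

text \<open>An abstract reflexive and symmetric \<open>R\<close> serves the graph and its complement
  alike, \<open>R v\<close> being the closed neighbourhood of \<open>v\<close>. The premise on
  \<open>w\<close> is an inequality so that it passes to subsets of \<open>W\<close> in the
  induction.\<close>

lemma greedy_partition:
  fixes R :: "'a \<Rightarrow> 'a \<Rightarrow> bool" and w :: "'a \<Rightarrow> nat"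
  assumes "finite W"
    and refl: "\<And>v. v \<in> W \<Longrightarrow> R v v"
    and sym: "\<And>u v. R u v \<Longrightarrow> R v u"
    and bound: "\<And>v. v \<in> W \<Longrightarrow> card {u \<in> W. R v u} \<le> w v"
  shows "\<exists>P K. partition_on W P \<and> (\<forall>A\<in>P. \<forall>u\<in>A. card A \<le> w u) \<and>
    K \<subseteq> W \<and> card K = card P \<and> (\<forall>u\<in>K. \<forall>v\<in>K. u \<noteq> v \<longrightarrow> \<not> R u v)"
  using assms(1,2,4)
proof (induction W rule: finite_psubset_induct)
  case (psubset W)
  show ?case
  proof (cases "W = {}")
    case True
    then show ?thesis by (intro exI[of _ "{}"]) (auto simp: partition_on_def)
  next
    case False
    \<comment> \<open>Minimality of \<open>w v\<close> makes the block admissible: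
      \<open>card A \<le> w v \<le> w u\<close> for every \<open>u\<close> in
      \<open>A\<close>.\<close>
    then obtain v where v: "v \<in> W" "\<And>u. u \<in> W \<Longrightarrow> w v \<le> w u"
      using arg_min_if_finite[OF \<open>finite W\<close>, of w] by (meson not_less)
    define A where "A = {u \<in> W. R v u}"
    have A: "v \<in> A" "A \<subseteq> W" "finite A"
      using v(1) psubset.prems(1) psubset.hyps by (auto simp: A_def)
    have "card {u \<in> W - A. R x u} \<le> w x" if "x \<in> W - A" for x
    proof -
      have "card {u \<in> W - A. R x u} \<le> card {u \<in> W. R x u}"
        by (intro card_mono) (use psubset.hyps in auto)
      then show ?thesis using psubset.prems(2)[of x] that by auto
    qed
    moreover have "W - A \<subset> W" using A by auto
    ultimately obtain P K where P: "partition_on (W - A) P" "\<forall>B\<in>P. \<forall>u\<in>B. card B \<le> w u"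
      and K: "K \<subseteq> W - A" "card K = card P" "\<forall>u\<in>K. \<forall>x\<in>K. u \<noteq> x \<longrightarrow> \<not> R u x"
      using psubset.IH[of "W - A"] psubset.prems(1) by auto
    have "partition_on W (insert A P)"
      using P(1) A by (auto simp: partition_on_def disjoint_def)
    moreover have "\<forall>B\<in>insert A P. \<forall>u\<in>B. card B \<le> w u"
      using P(2) psubset.prems(2)[OF v(1)] v(2) by (force simp: A_def)
    moreover have "insert v K \<subseteq> W" using v K by auto
    \<comment> \<open>Both sides grow by one: \<open>v\<close> lies in \<open>A\<close>, hence
      outside \<open>W - A\<close>, which contains \<open>K\<close> and all blocks of
      \<open>P\<close>.\<close>
    moreover have "card (insert v K) = card (insert A P)"
    proof -
      have "finite (W - A)" using psubset.hyps by simp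
      then have "finite P" "finite K"
        using P(1) K(1) finite_elements finite_subset by blast+
      moreover have "v \<notin> K" using K(1) A by auto
      moreover have "A \<notin> P" using P(1) A by (auto simp: partition_on_def)
      ultimately show ?thesis using K(2) by simp
    qed
    \<comment> \<open>Everything in \<open>W\<close> related to \<open>v\<close> went into
      \<open>A\<close>, so nothing in \<open>K\<close> is.\<close>
    moreover have "\<forall>u\<in>insert v K. \<forall>x\<in>insert v K. u \<noteq> x \<longrightarrow> \<not> R u x"
      using K sym by (auto simp: A_def)
    ultimately show ?thesis by blast
  qed
qed

lemma sum_reciprocal_le_card_partition:
  fixes w :: "'a \<Rightarrow> real"
  assumes "finite V" "partition_on V P" "\<And>A u. A \<in> P \<Longrightarrow> u \<in> A \<Longrightarrow> real (card A) \<le> w u"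
  shows "(\<Sum>v\<in>V. 1 / w v) \<le> real (card P)"
proof -
  have fin: "\<And>A. A \<in> P \<Longrightarrow> finite A"
    using assms(1,2) by (auto simp: partition_on_def intro: finite_subset)
  have "(\<Sum>v\<in>V. 1 / w v) = (\<Sum>A\<in>P. \<Sum>v\<in>A. 1 / w v)"
    using assms(2) sum.Union_disjoint[of P "\<lambda>v. 1 / w v"] fin
    by (auto simp: partition_on_def disjoint_def)
  also have "\<dots> \<le> (\<Sum>A\<in>P. 1)"
  proof (rule sum_mono)
    fix A assume A: "A \<in> P"
    \<comment> \<open>Blocks are nonempty, so each of the \<open>card A\<close> terms is at most
      \<open>1 / card A\<close>.\<close>
    then have pos: "0 < real (card A)"
      using fin assms(2) by (auto simp: partition_on_def card_gt_0_iff)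
    have "(\<Sum>v\<in>A. 1 / w v) \<le> (\<Sum>v\<in>A. 1 / real (card A))"
      using assms(3)[OF A] pos by (intro sum_mono frac_le) auto
    also have "\<dots> = 1" using pos by simp
    finally show "(\<Sum>v\<in>A. 1 / w v) \<le> 1" .
  qed
  finally show ?thesis by simp
qed

text \<open>Here \<open>m\<close> is the mean of \<open>w\<close>. The convex function
  \<open>1 / x\<close> lies above its tangent at \<open>m\<close>, and the tangent values sum to
  \<open>2 * card V / m - card V / m\<close>.\<close>

lemma sum_reciprocal_ge:
  fixes w :: "'a \<Rightarrow> real"
  assumes "\<And>v. v \<in> V \<Longrightarrow> 0 < w v" "0 < m" "(\<Sum>v\<in>V. w v) = real (card V) * m"
  shows "real (card V) / m \<le> (\<Sum>v\<in>V. 1 / w v)"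
proof -
  have tangent: "2 / m - w v / m\<^sup>2 \<le> 1 / w v" if "v \<in> V" for v
  proof -
    \<comment> \<open>This square is exactly the gap between \<open>1 / x\<close> and its tangent at
      \<open>m\<close>, for \<open>x = w v\<close>.\<close>
    have "0 \<le> (w v - m)\<^sup>2 / (w v * m\<^sup>2)" using assms(1)[OF that] by simp
    also have "\<dots> = 1 / w v - (2 / m - w v / m\<^sup>2)"
      using assms(1)[OF that] assms(2) by (simp add: field_simps power2_eq_square)
    finally show ?thesis by simp
  qed
  have "real (card V) / m = (\<Sum>v\<in>V. 2 / m - w v / m\<^sup>2)"
    using assms(2) by (simp add: sum_subtractf flip: sum_divide_distrib)
      (simp add: assms(3) field_simps power2_eq_square)
  also have "\<dots> \<le> (\<Sum>v\<in>V. 1 / w v)" using tangent by (rule sum_mono)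
  finally show ?thesis .
qed

context simple_graph
begin

lemma clique_number_ge: "K \<subseteq> V \<Longrightarrow> clique K E \<Longrightarrow> card K \<le> \<omega> V E"
  unfolding clique_number_def
  by (rule Max_ge) (auto intro!: finite_subset[of _ "card ` Pow V"] simp: finite_V)

lemma independence_number_ge: "K \<subseteq> V \<Longrightarrow> indep K E \<Longrightarrow> card K \<le> \<alpha> V E"
  unfolding independence_number_def
  by (rule Max_ge) (auto intro!: finite_subset[of _ "card ` Pow V"] simp: finite_V)

text \<open>By \<open>degree_less\<close> the subtraction on \<open>nat\<close> does not truncate
  here, which gives smallness the form that \<open>greedy_partition\<close> delivers.\<close>

lemma small_set_iff:
  "small_set V E A \<longleftrightarrow> A \<subseteq> V \<and> (\<forall>v\<in>A. card A \<le> card V - degree V E v)"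
  using degree_less by (force simp: small_set_def)

lemma large_set_iff:
  "large_set V E A \<longleftrightarrow> A \<subseteq> V \<and> (\<forall>v\<in>A. card A \<le> degree V E v + 1)"
  by (force simp: large_set_def)

lemma not_loop: "{v} \<notin> E"
  using E_subset by (auto simp: nsets_def)

lemma small_partition_number_le_clique_number: "\<phi> V E \<le> \<omega> V E"
proof -
  have "card {u \<in> V. {v, u} \<notin> E} = card V - degree V E v" for v
  proof -
    have "{u \<in> V. {v, u} \<notin> E} = V - {u \<in> V. {v, u} \<in> E}" by auto
    then show ?thesis by (simp add: degree_def card_Diff_subset finite_V)
  qed
  then obtain P K where P: "partition_on V P" "\<forall>A\<in>P. \<forall>u\<in>A. card A \<le> card V - degree V E u"
    and K: "K \<subseteq> V" "card K = card P" "\<forall>u\<in>K. \<forall>v\<in>K. u \<noteq> v \<longrightarrow> {u, v} \<in> E"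
    \<comment> \<open>Non-adjacency is reflexive because there are no loops; pairwise unrelated
      vertices then form a clique.\<close>
    using greedy_partition[of V "\<lambda>v u. {v, u} \<notin> E" "\<lambda>v. card V - degree V E v"]
    by (auto simp: finite_V not_loop insert_commute)
  have "\<forall>A\<in>P. small_set V E A"
    using P by (auto simp: small_set_iff partition_on_def)
  then have "\<phi> V E \<le> card P"
    unfolding small_partition_number_def using P(1) by (intro Least_le) blast
  also have "\<dots> \<le> \<omega> V E"
    using clique_number_ge[OF K(1)] K(2,3) by (auto simp: clique_def)
  finally show ?thesis .
qed

lemma large_partition_number_le_independence_number: "\<Omega> V E \<le> \<alpha> V E"
proof -
  \<comment> \<open>Adjacency has to be made reflexive by hand; the vertex \<open>v\<close> itself
    accounts for the \<open>+ 1\<close>.\<close>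
  have "card {u \<in> V. u = v \<or> {v, u} \<in> E} = degree V E v + 1" if "v \<in> V" for v
  proof -
    have "{u \<in> V. u = v \<or> {v, u} \<in> E} = insert v {u \<in> V. {v, u} \<in> E}" using that by auto
    then show ?thesis by (simp add: degree_def finite_V not_loop)
  qed
  moreover have "v = u \<or> {u, v} \<in> E \<Longrightarrow> u = v \<or> {v, u} \<in> E" for u v
    by (auto simp: insert_commute)
  ultimately obtain P K where P: "partition_on V P" "\<forall>A\<in>P. \<forall>u\<in>A. card A \<le> degree V E u + 1"
    and K: "K \<subseteq> V" "card K = card P" "\<forall>u\<in>K. \<forall>v\<in>K. u \<noteq> v \<longrightarrow> {u, v} \<notin> E"
    using greedy_partition[of V "\<lambda>v u. u = v \<or> {v, u} \<in> E" "\<lambda>v. degree V E v + 1"]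
    by (auto simp: finite_V)
  have "\<forall>A\<in>P. large_set V E A"
    using P by (auto simp: large_set_iff partition_on_def)
  then have "\<Omega> V E \<le> card P"
    unfolding large_partition_number_def using P(1) by (intro Least_le) blast
  also have "\<dots> \<le> \<alpha> V E"
    using independence_number_ge[OF K(1)] K(2,3) by (auto simp: indep_def)
  finally show ?thesis .
qed

lemma sum_le_small_partition_number:
  "(\<Sum>v\<in>V. 1 / (real (card V) - real (degree V E v))) \<le> real (\<phi> V E)"
proof -
  obtain P where P: "partition_on V P" "card P = \<phi> V E" "\<forall>A\<in>P. small_set V E A"
    using small_partition_number_attained by blast
  have "real (card A) \<le> real (card V) - real (degree V E u)" if "A \<in> P" "u \<in> A" for A u
    using P(3) that by (force simp: small_set_def)
  from sum_reciprocal_le_card_partition[OF finite_V P(1) this] show ?thesis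
    by (simp add: P(2))
qed

lemma sum_le_large_partition_number:
  "(\<Sum>v\<in>V. 1 / (real (degree V E v) + 1)) \<le> real (\<Omega> V E)"
proof -
  obtain P where P: "partition_on V P" "card P = \<Omega> V E" "\<forall>A\<in>P. large_set V E A"
    using large_partition_number_attained by blast
  have "real (card A) \<le> real (degree V E u) + 1" if "A \<in> P" "u \<in> A" for A u
    using P(3) that by (force simp: large_set_def)
  from sum_reciprocal_le_card_partition[OF finite_V P(1) this] show ?thesis
    by (simp add: P(2))
qed

lemma card_V_pos: "0 < card V"
  using finite_V V_nonempty by (simp add: card_gt_0_iff)

lemma sum_degree_eq: "(\<Sum>v\<in>V. real (degree V E v)) = real (card V) * avg_degree V E"
  using card_V_pos by (simp add: avg_degree_def)

lemma avg_degree_nonneg: "0 \<le> avg_degree V E"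
  by (simp add: avg_degree_def sum_nonneg)

text \<open>Strictness makes \<open>n - d\<close>, the mean of the values \<open>n - deg v\<close>,
  positive.\<close>

lemma avg_degree_less: "avg_degree V E < real (card V)"
proof -
  have "(\<Sum>v\<in>V. real (degree V E v)) < (\<Sum>v\<in>V. real (card V))"
    using degree_less by (intro sum_strict_mono finite_V V_nonempty) simp
  then show ?thesis using card_V_pos by (simp add: sum_degree_eq)
qed

end

theorem corollary4p2:
  fixes V :: "'a set" and E :: "'a set set" and n :: nat and d :: real
  assumes "simple_graph V E"
    and "n = card V"
    and "d = avg_degree V E"
  shows "(\<omega> V E \<ge> \<phi> V E \<and>
          real (\<phi> V E) \<ge> (\<Sum>v\<in>V. 1 / (real n - real (degree V E v))) \<and>
          (\<Sum>v\<in>V. 1 / (real n - real (degree V E v))) \<ge> real n / (real n - d))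
       \<and> (\<alpha> V E \<ge> \<Omega> V E \<and>
          real (\<Omega> V E) \<ge> (\<Sum>v\<in>V. 1 / (real (degree V E v) + 1)) \<and>
          (\<Sum>v\<in>V. 1 / (real (degree V E v) + 1)) \<ge> real n / (d + 1))"
proof -
  interpret simple_graph V E by fact
  have "real n / (real n - d) \<le> (\<Sum>v\<in>V. 1 / (real n - real (degree V E v)))"
    unfolding assms(2,3)
    \<comment> \<open>The mean \<open>m\<close> is \<open>n - d\<close> here and
      \<open>d + 1\<close> in the second part.\<close>
    by (rule sum_reciprocal_ge)
      (use degree_less avg_degree_less in \<open>auto simp: sum_subtractf sum_degree_eq algebra_simps\<close>)
  moreover have "real n / (d + 1) \<le> (\<Sum>v\<in>V. 1 / (real (degree V E v) + 1))"
    unfolding assms(2,3)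
    by (rule sum_reciprocal_ge)
      (use avg_degree_nonneg in \<open>auto simp: sum.distrib sum_degree_eq algebra_simps\<close>)
  ultimately show ?thesis
    using small_partition_number_le_clique_number sum_le_small_partition_number
      large_partition_number_le_independence_number sum_le_large_partition_number
    by (simp add: assms(2))
qed

end
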